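(* For every $n\ge 1$, the average weight index $\mathrm{AWI}:\mathcal{W}_n\to\mathbb{R}^n$ and the average representation index $\mathrm{ARI}:\mathcal{W}_n\to\mathbb{R}^n$ are representation compatible; that is, for every weighted majority game $v\in\mathcal{W}_n$ the vectors $\mathrm{AWI}(v)$ and $\mathrm{ARI}(v)$ are both feasible weight vectors for $v$.
   Context: Let $N=\{1,\dots,n\}$. A simple game is a map $v:2^N\to\{0,1\}$ with $v(\emptyset)=0$, $v(N)=1$ and $v(S)\le v(T)$ whenever $S\subseteq T\subseteq N$. A coalition $S\subseteq N$ is winning if $v(S)=1$ and losing otherwise. For $w\in\mathbb{R}^n$ and $S\subseteq N$ write $w(S)=\sum_{i\in S}w_i$. A pair $(q,w)$ with real $q>0$ and $w\in\mathbb{R}^n_{\ge 0}$ is a representation of $v$ if $w(S)\ge q$ for all winning coalitions $S$ and $w(T)<q$ for all losing coalitions $T$. The game $v$ is a weighted majority game if it has a representation; $\mathcal{W}_n$ is the set of weighted majority games on $n$ voters. A weight vector $w\in\mathbb{R}^n_{\ge 0}$ is feasible for $v$ if there is a $q$ such that $(q,w)$ is a representation of $v$. A weight vector is normalized if $\sum_{i=1}^n w_i=1$; a representation $(q,w)$ is normalized if $\sum_{i=1}^n w_i=1$ and $q\in(0,1]$. A power index $g:\mathcal{W}_n\to\mathbb{R}^n$ is representation compatible if $g(v)$ is feasible for $v$, for all $v\in\mathcal{W}_n$. The average weight index $\mathrm{AWI}(v)$ is the average of all normalized weight vectors feasible for $v$: with $F$ the set of these vectors, $\mathrm{AWI}_i(v)=\int_F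 w_i\,dw\,/\int_F dw$, where $dw$ is $(n-1)$-dimensional Lebesgue measure on the hyperplane $\sum_i w_i=1$ (equivalently, Lebesgue measure in the coordinates $w_1,\dots,w_{n-1}$ after substituting $w_n=1-w_1-\dots-w_{n-1}$; for $n=1$ this is the unit point mass). The average representation index $\mathrm{ARI}(v)$ is the weight part of the average of all normalized representations of $v$: with $R$ the set of normalized representations $(q,w)$ of $v$, $\mathrm{ARI}_i(v)=\int_R w_i\,d(q,w)\,/\int_R d(q,w)$, where $d(q,w)$ is $n$-dimensional Lebesgue measure on $\{(q,w)\in\mathbb{R}^{n+1}:\sum_i w_i=1\}$ (equivalently, in the coordinates $q,w_1,\dots,w_{n-1}$). *)

theory Defs
  imports "HOL-Analysis.Analysis"
begin

text \<open>
  Voters are \<open>{1..n}\<close>. Vectors in \<open>\<real>\<^sup>n\<close> and games are extensional functions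
  (undefined off \<open>{1..n}\<close>, resp. off \<open>Pow {1..n}\<close>), so that each object has exactly one
  representative and \<open>n\<close> stays an ordinary natural number.
\<close>

definition simple_games :: "nat \<Rightarrow> (nat set \<Rightarrow> nat) set" where
  "simple_games n = {v \<in> Pow {1..n} \<rightarrow>\<^sub>E {0, 1}.
     v {} = 0 \<and> v {1..n} = 1 \<and> (\<forall>S T. S \<subseteq> T \<and> T \<subseteq> {1..n} \<longrightarrow> v S \<le> v T)}"

definition winning :: "nat \<Rightarrow> (nat set \<Rightarrow> nat) \<Rightarrow> nat set \<Rightarrow> bool" where
  "winning n v S \<longleftrightarrow> S \<subseteq> {1..n} \<and> v S = 1"

definition losing :: "nat \<Rightarrow> (nat set \<Rightarrow> nat) \<Rightarrow> nat set \<Rightarrow> bool" where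
  "losing n v S \<longleftrightarrow> S \<subseteq> {1..n} \<and> v S \<noteq> 1"

definition is_representation ::
    "nat \<Rightarrow> (nat set \<Rightarrow> nat) \<Rightarrow> real \<Rightarrow> (nat \<Rightarrow> real) \<Rightarrow> bool" where
  "is_representation n v q w \<longleftrightarrow>
     q > 0 \<and> w \<in> {1..n} \<rightarrow>\<^sub>E {0..} \<and>
     (\<forall>S. winning n v S \<longrightarrow> sum w S \<ge> q) \<and>
     (\<forall>T. losing n v T \<longrightarrow> sum w T < q)"

definition weighted_games :: "nat \<Rightarrow> (nat set \<Rightarrow> nat) set" where
  "weighted_games n = {v \<in> simple_games n. \<exists>q w. is_representation n v q w}"

definition feasible :: "nat \<Rightarrow> (nat set \<Rightarrow> nat) \<Rightarrow> (nat \<Rightarrow> real) \<Rightarrow> bool" where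
  "feasible n v w \<longleftrightarrow> (\<exists>q. is_representation n v q w)"

definition representation_compatible ::
    "nat \<Rightarrow> ((nat set \<Rightarrow> nat) \<Rightarrow> (nat \<Rightarrow> real)) \<Rightarrow> bool" where
  "representation_compatible n g \<longleftrightarrow> (\<forall>v \<in> weighted_games n. feasible n v (g v))"

definition normalized_weights :: "nat \<Rightarrow> (nat set \<Rightarrow> nat) \<Rightarrow> (nat \<Rightarrow> real) set" where
  "normalized_weights n v = {w. feasible n v w \<and> (\<Sum>i=1..n. w i) = 1}"

definition normalized_representations ::
    "nat \<Rightarrow> (nat set \<Rightarrow> nat) \<Rightarrow> (real \<times> (nat \<Rightarrow> real)) set" where
  "normalized_representations n v =
     {(q, w). is_representation n v q w \<and> (\<Sum>i=1..n. w i) = 1 \<and> q \<in> {0<..1}}"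

text \<open>
  Lebesgue measure on the hyperplane \<open>w\<^sub>1 + \<dots> + w\<^sub>n = 1\<close> (for \<open>n \<ge> 1\<close>), taken in the
  coordinates \<open>w\<^sub>1, \<dots>, w\<^sub>n\<^sub>-\<^sub>1\<close> via \<open>w\<^sub>n = 1 - w\<^sub>1 - \<dots> - w\<^sub>n\<^sub>-\<^sub>1\<close>; the constant factor
  between this and surface measure (\<open>sqrt n\<close>) cancels in averages. For \<open>n = 1\<close> the empty product is a
  unit point mass.
\<close>

definition from_coords :: "nat \<Rightarrow> (nat \<Rightarrow> real) \<Rightarrow> (nat \<Rightarrow> real)" where
  "from_coords n x = x(n := 1 - (\<Sum>i=1..<n. x i))"

definition weight_measure :: "nat \<Rightarrow> (nat \<Rightarrow> real) measure" where
  "weight_measure n =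
     distr (\<Pi>\<^sub>M i\<in>{1..<n}. lborel) (\<Pi>\<^sub>M i\<in>{1..n}. lborel) (from_coords n)"

definition representation_measure :: "nat \<Rightarrow> (real \<times> (nat \<Rightarrow> real)) measure" where
  "representation_measure n =
     distr (lborel \<Otimes>\<^sub>M (\<Pi>\<^sub>M i\<in>{1..<n}. lborel)) (lborel \<Otimes>\<^sub>M (\<Pi>\<^sub>M i\<in>{1..n}. lborel))
       (\<lambda>(q, x). (q, from_coords n x))"

definition AWI :: "nat \<Rightarrow> (nat set \<Rightarrow> nat) \<Rightarrow> (nat \<Rightarrow> real)" where
  "AWI n v = (\<lambda>i\<in>{1..n}.
     (LINT w:normalized_weights n v|weight_measure n. w i) /
     (LINT w:normalized_weights n v|weight_measure n. 1))"

definition ARI :: "nat \<Rightarrow> (nat set \<Rightarrow> nat) \<Rightarrow> (nat \<Rightarrow> real)" where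
  "ARI n v = (\<lambda>i\<in>{1..n}.
     (LINT r:normalized_representations n v|representation_measure n. snd r i) /
     (LINT r:normalized_representations n v|representation_measure n. 1))"

end

theory Submission
  imports Defs
begin

text \<open>
  A weight vector is feasible iff it is nonnegative and satisfies \<open>w(T) < w(S)\<close> for all losing \<open>T\<close> and
  winning \<open>S\<close>. These are linear inequalities, so they survive averaging over any set of positive
  finite measure. Positivity of the measure holds because raising every weight of a representation
  by the same small amount makes all inequalities strict, so the normalized representations
  contain an open box.
\<close>

section \<open>Feasibility as linear inequalities, and its stability under averaging\<close>

lemma weighted_games_simple: "v \<in> weighted_games n \<Longrightarrow> v \<in> simple_games n"
  by (simp add: weighted_games_def)

lemma winning_not_empty:
  "v \<in> simple_games n \<Longrightarrow> winning n v S \<Longrightarrow> S \<noteq> {}"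
  by (auto simp: simple_games_def winning_def)

lemma losing_empty: "v \<in> simple_games n \<Longrightarrow> losing n v {}"
  by (auto simp: simple_games_def losing_def)

lemma winning_all: "v \<in> simple_games n \<Longrightarrow> winning n v {1..n}"
  by (auto simp: simple_games_def winning_def)

lemma finite_winning: "finite {S. winning n v S}"
  by (rule finite_subset[of _ "Pow {1..n}"]) (auto simp: winning_def)

lemma finite_losing: "finite {T. losing n v T}"
  by (rule finite_subset[of _ "Pow {1..n}"]) (auto simp: losing_def)

text \<open>This eliminates the quota. The least weight of a winning coalition can serve as quota:
  it exists because there are finitely many coalitions and the grand coalition wins, and it is
  positive because the empty coalition loses and has weight 0.\<close>

lemma feasible_iff:
  assumes v: "v \<in> simple_games n"
  shows "feasible n v w \<longleftrightarrow> w \<in> {1..n} \<rightarrow>\<^sub>E {0..} \<and>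
    (\<forall>S T. winning n v S \<longrightarrow> losing n v T \<longrightarrow> sum w T < sum w S)"
proof
  assume "feasible n v w"
  then show "w \<in> {1..n} \<rightarrow>\<^sub>E {0..} \<and>
    (\<forall>S T. winning n v S \<longrightarrow> losing n v T \<longrightarrow> sum w T < sum w S)"
    unfolding feasible_def is_representation_def by (blast intro: less_le_trans)
next
  assume R: "w \<in> {1..n} \<rightarrow>\<^sub>E {0..} \<and>
    (\<forall>S T. winning n v S \<longrightarrow> losing n v T \<longrightarrow> sum w T < sum w S)"
  let ?X = "sum w ` {S. winning n v S}"
  have X: "finite ?X" "?X \<noteq> {}"
    using finite_winning winning_all[OF v] by auto
  from Min_in[OF this] obtain S where S: "winning n v S" "Min ?X = sum w S"
    by blast
  have "is_representation n v (Min ?X) w"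
    unfolding is_representation_def
  proof (intro conjI allI impI)
    show "0 < Min ?X"
      using R S losing_empty[OF v] by fastforce
    show "w \<in> {1..n} \<rightarrow>\<^sub>E {0..}" using R by blast
    show "Min ?X \<le> sum w S" if "winning n v S" for S
      using X that by (intro Min_le) auto
    show "sum w T < Min ?X" if "losing n v T" for T
      using R S that by auto
  qed
  then show "feasible n v w" unfolding feasible_def by blast
qed

text \<open>A strict linear inequality that holds pointwise on a set of positive finite measure also
  holds for the integrals, and dividing by the measure preserves it. The map \<open>p\<close>
  extracts the weights from a point, so that one lemma covers averages over weight vectors and over
  pairs of quota and weights.\<close>

lemma average_feasible:
  fixes p :: "'a \<Rightarrow> nat \<Rightarrow> real"
  assumes v: "v \<in> simple_games n"
    and A: "A \<in> sets M" "emeasure M A \<noteq> 0" "emeasure M A \<noteq> \<infinity>"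
    and meas: "\<And>i. i \<in> {1..n} \<Longrightarrow> (\<lambda>x. p x i) \<in> borel_measurable M"
    and feas: "\<And>x. x \<in> A \<Longrightarrow> feasible n v (p x)"
    and norm: "\<And>x. x \<in> A \<Longrightarrow> (\<Sum>i=1..n. p x i) = 1"
  shows "feasible n v (\<lambda>i\<in>{1..n}. (LINT x:A|M. p x i) / (LINT x:A|M. 1))"
proof -
  define m where "m = (LINT x:A|M. (1::real))"
  define a where "a = (\<lambda>i. LINT x:A|M. p x i)"
  have m: "m = measure M A"
    using A by (simp add: m_def set_integral_const top.not_eq_extremum)
  have m0: "m > 0"
    unfolding m using A by (simp add: measure_def enn2real_positive_iff top.not_eq_extremum zero_less_iff_neq_zero)
  have nonneg: "0 \<le> p x i" if "x \<in> A" "i \<in> {1..n}" for x i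
    using feas[OF that(1)] that(2) unfolding feasible_iff[OF v] by (auto simp: PiE_iff)
  \<comment> \<open>Normalization bounds the coordinates; since \<open>A\<close> has finite measure,
    its indicator then dominates the integrands.\<close>
  have le1: "p x i \<le> 1" if "x \<in> A" "i \<in> {1..n}" for x i
    using norm[OF that(1)] member_le_sum[of i "{1..n}" "p x"] nonneg that by auto
  have int: "set_integrable M A (\<lambda>x. p x i)" if "i \<in> {1..n}" for i
    unfolding set_integrable_def
  proof (rule Bochner_Integration.integrable_bound)
    show "integrable M (indicator A :: 'a \<Rightarrow> real)"
      using A by (simp add: integrable_indicator_iff top.not_eq_extremum)
    show "(\<lambda>x. indicat_real A x *\<^sub>R p x i) \<in> borel_measurable M"
      using A meas[OF that] by simp
    show "AE x in M. norm (indicat_real A x *\<^sub>R p x i) \<le> norm (indicat_real A x)"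
      using nonneg le1 that by (auto simp: indicator_def)
  qed
  have a0: "0 \<le> a i" if "i \<in> {1..n}" for i
    unfolding a_def set_lebesgue_integral_def
    by (rule Bochner_Integration.integral_nonneg) (use nonneg that in \<open>auto simp: indicator_def\<close>)
  have int_sum: "integrable M (\<lambda>x. indicat_real A x *\<^sub>R sum (p x) S)"
    and sum_a: "sum a S = (LINT x|M. indicat_real A x *\<^sub>R sum (p x) S)"
    if "S \<subseteq> {1..n}" for S
    using int that unfolding a_def set_lebesgue_integral_def set_integrable_def
    by (auto simp: sum_distrib_left subset_iff
        intro!: Bochner_Integration.integral_sum[symmetric])
  have strict: "sum a T < sum a S" if "winning n v S" "losing n v T" for S T
  proof -
    have sub: "S \<subseteq> {1..n}" "T \<subseteq> {1..n}"
      using that by (auto simp: winning_def losing_def)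
    have lt: "sum (p x) T < sum (p x) S" if "x \<in> A" for x
      using feas[OF that] \<open>winning n v S\<close> \<open>losing n v T\<close> unfolding feasible_iff[OF v] by blast
    let ?g = "\<lambda>x. indicat_real A x *\<^sub>R sum (p x) S - indicat_real A x *\<^sub>R sum (p x) T"
    have g: "integrable M ?g" "AE x in M. 0 \<le> ?g x"
      using int_sum sub by simp (use lt in \<open>auto simp: indicator_def intro: less_imp_le\<close>)
    have "integral\<^sup>L M ?g \<noteq> 0"
    proof
      assume "integral\<^sup>L M ?g = 0"
      then have "AE x in M. ?g x = 0"
        using integral_nonneg_eq_0_iff_AE[OF g] by simp
      \<comment> \<open>The integrand is strictly positive on \<open>A\<close>, so its vanishing
        almost everywhere would make \<open>A\<close> a null set.\<close>
      then have "AE x in M. x \<notin> A"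
      proof (eventually_elim)
        fix x assume "?g x = 0"
        then show "x \<notin> A" using lt[of x] by auto
      qed
      then show False using A(1,2) AE_iff_measurable[OF A(1), of "\<lambda>x. x \<notin> A"] sets.sets_into_space[OF A(1)]
        by auto
    qed
    with integral_nonneg_AE[OF g(2)] have "0 < integral\<^sup>L M ?g" by linarith
    then show ?thesis
      using sub int_sum by (simp add: sum_a)
  qed
  have res: "sum (\<lambda>i\<in>{1..n}. a i / m) S = sum a S / m" if "S \<subseteq> {1..n}" for S
    using that unfolding sum_divide_distrib by (intro sum.cong) auto
  have "feasible n v (\<lambda>i\<in>{1..n}. a i / m)"
    unfolding feasible_iff[OF v]
  proof (intro conjI allI impI)
    show "(\<lambda>i\<in>{1..n}. a i / m) \<in> {1..n} \<rightarrow>\<^sub>E {0..}"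
      using a0 m0 by (auto simp: PiE_iff)
    fix S T assume ST: "winning n v S" "losing n v T"
    then have "S \<subseteq> {1..n}" "T \<subseteq> {1..n}" by (auto simp: winning_def losing_def)
    with strict[OF ST] m0 show "sum (\<lambda>i\<in>{1..n}. a i / m) T < sum (\<lambda>i\<in>{1..n}. a i / m) S"
      by (simp only: res divide_strict_right_mono)
  qed
  then show ?thesis unfolding a_def m_def .
qed

section \<open>A normalized representation with slack in every inequality\<close>

lemma ex_lower_bound_finite:
  fixes f :: "'a \<Rightarrow> real"
  assumes "finite X" "\<And>x. x \<in> X \<Longrightarrow> 0 < f x"
  obtains d where "0 < d" "\<And>x. x \<in> X \<Longrightarrow> d < f x"
proof -
  have "\<exists>d>0. \<forall>x\<in>X. d < f x"
    using assms
  proof (induction X)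
    case empty
    then show ?case by (auto intro: exI[of _ 1])
  next
    case (insert y X)
    then obtain d where "d > 0" "\<forall>x\<in>X. d < f x" by auto
    then show ?case
      using insert.prems[of y] by (intro exI[of _ "min d (f y / 2)"]) auto
  qed
  with that show thesis by blast
qed

text \<open>An arbitrary representation may have zero weights or winning coalitions exactly at the
  quota. Adding \<open>c\<close> to every weight removes both, and dividing by the total normalizes.
  The slack at the quota is \<open>2 * d\<close> because weight sums and quota will later be
  perturbed independently, each by at most \<open>d\<close>. The vector \<open>w\<close> is only the
  centre of a box, so it need not be extensional and \<open>is_representation\<close> is not
  asserted of it.\<close>

lemma ex_interior_representation:
  assumes v: "v \<in> weighted_games n"
  obtains q :: real and w d where "d > 0" "(\<Sum>i=1..n. w i) = 1"
    "\<And>i. i \<in> {1..n} \<Longrightarrow> d < w i"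
    "\<And>S. winning n v S \<Longrightarrow> q + 2 * d < sum w S"
    "\<And>T. losing n v T \<Longrightarrow> sum w T < q - 2 * d"
proof -
  have sg: "v \<in> simple_games n" by (rule weighted_games_simple[OF v])
  obtain q w where rep: "is_representation n v q w"
    using v by (auto simp: weighted_games_def)
  have q0: "q > 0" and w0: "\<And>i. i \<in> {1..n} \<Longrightarrow> 0 \<le> w i"
    and win: "\<And>S. winning n v S \<Longrightarrow> q \<le> sum w S"
    and lose: "\<And>T. losing n v T \<Longrightarrow> sum w T < q"
    using rep by (auto simp: is_representation_def PiE_iff)
  \<comment> \<open>\<open>e\<close> is a common slack of the losing coalitions, whose inequalities
    are already strict.\<close>
  obtain e where e: "e > 0" "\<And>T. losing n v T \<Longrightarrow> e < q - sum w T"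
    using ex_lower_bound_finite[OF finite_losing, of n v "\<lambda>T. q - sum w T"] lose by auto
  \<comment> \<open>A losing coalition gains at most \<open>n * c\<close>; the denominator
    \<open>n + 1\<close> keeps this strictly below the slack \<open>e\<close>.\<close>
  define c where "c = e / (real n + 1)"
  have c: "c > 0" "real n * c < e"
    using e by (auto simp: c_def field_simps)
  define u where "u = (\<lambda>i. w i + c)"
  have u_sum: "sum u S = sum w S + real (card S) * c" for S
    by (simp add: u_def sum.distrib)
  have u_win: "q < sum u S" if "winning n v S" for S
  proof -
    \<comment> \<open>A winning coalition is nonempty, so it gains at least \<open>c\<close> and
      passes the quota strictly.\<close>
    have "card S > 0"
      using winning_not_empty[OF sg that] that
      by (auto simp: winning_def card_gt_0_iff intro: finite_subset)
    then show ?thesis using win[OF that] mult_pos_pos[of "real (card S)" c] c(1) unfolding u_sum by linarith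
  qed
  have u_lose: "sum u T < q" if "losing n v T" for T
  proof -
    have "card T \<le> n"
      using that card_mono[of "{1..n}" T] by (auto simp: losing_def)
    then have "real (card T) * c \<le> real n * c" using c by (intro mult_right_mono) auto
    then show ?thesis using e(2)[OF that] c unfolding u_sum by linarith
  qed
  define s where "s = sum u {1..n}"
  have s: "s > 0" using u_win[OF winning_all[OF sg]] q0 by (simp add: s_def)
  have sum_s: "sum (\<lambda>i. u i / s) S = sum u S / s" for S
    by (simp add: sum_divide_distrib)
  have u0: "0 < u i / s" if "i \<in> {1..n}" for i
    using w0[OF that] c s by (simp add: u_def add_nonneg_pos)
  obtain d1 where d1: "d1 > 0" "\<And>i. i \<in> {1..n} \<Longrightarrow> d1 < u i / s"
    using ex_lower_bound_finite[of "{1..n}" "\<lambda>i. u i / s"] u0 by auto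
  obtain d2 where d2: "d2 > 0" "\<And>S. winning n v S \<Longrightarrow> d2 < sum u S / s - q / s"
    using ex_lower_bound_finite[OF finite_winning, of n v "\<lambda>S. sum u S / s - q / s"] u_win s
    by (auto simp: divide_strict_right_mono)
  obtain d3 where d3: "d3 > 0" "\<And>T. losing n v T \<Longrightarrow> d3 < q / s - sum u T / s"
    using ex_lower_bound_finite[OF finite_losing, of n v "\<lambda>T. q / s - sum u T / s"] u_lose s
    by (auto simp: divide_strict_right_mono)
  define d where "d = min d1 (min (d2 / 2) (d3 / 2))"
  have d: "d > 0" "d \<le> d1" "2 * d \<le> d2" "2 * d \<le> d3"
    using d1 d2 d3 by (auto simp: d_def)
  show thesis
  proof (rule that[of d "\<lambda>i. u i / s" "q / s"])
    show "(\<Sum>i=1..n. u i / s) = 1" unfolding sum_s using s by (simp add: s_def)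
    show "d < u i / s" if "i \<in> {1..n}" for i using d1(2)[OF that] d by linarith
    show "q / s + 2 * d < (\<Sum>i\<in>S. u i / s)" if "winning n v S" for S
      using d2(2)[OF that] d unfolding sum_s by linarith
    show "(\<Sum>i\<in>T. u i / s) < q / s - 2 * d" if "losing n v T" for T
      using d3(2)[OF that] d unfolding sum_s by linarith
  qed (use d in auto)
qed

section \<open>A box of representations in the coordinates of the hyperplane\<close>

lemma from_coords_apply: "i \<noteq> n \<Longrightarrow> from_coords n x i = x i"
  "from_coords n x n = 1 - (\<Sum>i=1..<n. x i)"
  by (auto simp: from_coords_def)

lemma atLeastAtMost_eq_insert: "n \<ge> 1 \<Longrightarrow> {1..n} = insert n {1..<n::nat}"
  by auto

lemma sum_from_coords: "n \<ge> 1 \<Longrightarrow> (\<Sum>i=1..n. from_coords n x i) = 1"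
  by (simp add: atLeastAtMost_eq_insert from_coords_apply del: One_nat_def)

text \<open>The last weight moves by at most the total movement of the free coordinates, which is at
  most \<open>n * e\<close>. Counting both contributions bounds the l1 distance of the two weight
  vectors, hence the change of every coalition weight.\<close>

lemma from_coords_close:
  fixes w x :: "nat \<Rightarrow> real"
  assumes n: "n \<ge> 1" and w: "(\<Sum>i=1..n. w i) = 1" and S: "S \<subseteq> {1..n}" and e: "e > 0"
    and x: "\<And>i. i \<in> {1..<n} \<Longrightarrow> \<bar>x i - w i\<bar> < e"
  shows "\<bar>sum (from_coords n x) S - sum w S\<bar> \<le> 2 * real n * e"
proof -
  let ?y = "from_coords n x"
  have wn: "w n = 1 - (\<Sum>i=1..<n. w i)"
    using w n by (simp add: atLeastAtMost_eq_insert del: One_nat_def)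
  have le: "(\<Sum>i=1..<n. \<bar>x i - w i\<bar>) \<le> real n * e"
  proof -
    have "(\<Sum>i=1..<n. \<bar>x i - w i\<bar>) \<le> (\<Sum>i=1..<n. e)"
      by (intro sum_mono less_imp_le x)
    also have "\<dots> \<le> real n * e" using e by simp
    finally show ?thesis .
  qed
  have "\<bar>?y n - w n\<bar> = \<bar>\<Sum>i=1..<n. x i - w i\<bar>"
    by (simp add: from_coords_apply wn sum_subtractf del: One_nat_def)
  also have "\<dots> \<le> (\<Sum>i=1..<n. \<bar>x i - w i\<bar>)" by (rule sum_abs)
  finally have yn: "\<bar>?y n - w n\<bar> \<le> real n * e" using le by linarith
  have "\<bar>sum ?y S - sum w S\<bar> = \<bar>\<Sum>i\<in>S. ?y i - w i\<bar>" by (simp add: sum_subtractf)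
  also have "\<dots> \<le> (\<Sum>i\<in>S. \<bar>?y i - w i\<bar>)" by (rule sum_abs)
  also have "\<dots> \<le> (\<Sum>i=1..n. \<bar>?y i - w i\<bar>)" using S by (intro sum_mono2) auto
  also have "\<dots> = \<bar>?y n - w n\<bar> + (\<Sum>i=1..<n. \<bar>?y i - w i\<bar>)"
    using n by (simp add: atLeastAtMost_eq_insert del: One_nat_def)
  also have "(\<Sum>i=1..<n. \<bar>?y i - w i\<bar>) = (\<Sum>i=1..<n. \<bar>x i - w i\<bar>)"
    by (intro sum.cong) (auto simp: from_coords_apply)
  finally show ?thesis using yn le by linarith
qed

text \<open>The slack around an interior representation leaves room for a full-dimensional open box
  in the coordinates of quota and first \<open>n - 1\<close> weights. The box yields positive
  measure for both indices.\<close>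

lemma ex_box_of_representations:
  assumes n: "n \<ge> 1" and v: "v \<in> weighted_games n"
  obtains q :: real and w e where "e > 0"
    "\<And>q' x. q' \<in> {q - e<..<q + e} \<Longrightarrow> x \<in> (\<Pi>\<^sub>E i\<in>{1..<n}. {w i - e<..<w i + e}) \<Longrightarrow>
       is_representation n v q' (from_coords n x) \<and> q' \<in> {0<..1}"
proof -
  have sg: "v \<in> simple_games n" by (rule weighted_games_simple[OF v])
  obtain q d :: real and w where d: "d > 0" and w: "(\<Sum>i=1..n. w i) = 1"
    and pos: "\<And>i. i \<in> {1..n} \<Longrightarrow> d < w i"
    and win: "\<And>S. winning n v S \<Longrightarrow> q + 2 * d < sum w S"
    and lose: "\<And>T. losing n v T \<Longrightarrow> sum w T < q - 2 * d"
    by (rule ex_interior_representation[OF v]) blast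
  \<comment> \<open>With this radius the bound of \<open>from_coords_close\<close> is exactly
    \<open>d\<close>; moreover \<open>e \<le> d\<close>, so the quota also moves by less than
    \<open>d\<close>.\<close>
  define e where "e = d / (2 * real n)"
  have e: "e > 0" "2 * real n * e = d" "e \<le> d"
    using d n by (auto simp: e_def field_simps)
  show thesis
  proof (rule that[of e q w])
    fix q' x
    assume q': "q' \<in> {q - e<..<q + e}" and x: "x \<in> (\<Pi>\<^sub>E i\<in>{1..<n}. {w i - e<..<w i + e})"
    let ?y = "from_coords n x"
    have "\<bar>x i - w i\<bar> < e" if "i \<in> {1..<n}" for i
      using PiE_mem[OF x that] by (auto simp: abs_less_iff)
    then have close: "\<bar>sum ?y S - sum w S\<bar> \<le> d" if "S \<subseteq> {1..n}" for S
      using from_coords_close[OF n w that e(1), of x] e(2) by simp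
    have "0 \<le> ?y i" if "i \<in> {1..n}" for i
      using close[of "{i}"] pos[OF that] that by auto
    \<comment> \<open>The update at \<open>n\<close> turns a function extensional on
      \<open>{1..<n}\<close> into one extensional on \<open>{1..n}\<close>.\<close>
    moreover have "?y i = undefined" if "i \<notin> {1..n}" for i
      using x that n by (cases "i = n") (auto simp: from_coords_apply PiE_iff extensional_def)
    ultimately have y: "?y \<in> {1..n} \<rightarrow>\<^sub>E {0..}"
      by (auto simp: PiE_iff extensional_def simp del: One_nat_def)
    \<comment> \<open>The empty coalition loses with weight 0, so \<open>q - 2 * d\<close> is
      positive; the grand coalition wins with weight 1, so \<open>q + 2 * d\<close> is below
      1.\<close>
    have q0: "q' > 0" using lose[OF losing_empty[OF sg]] q' e by auto
    have q1: "q' \<le> 1" using win[OF winning_all[OF sg]] q' e d w by auto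
    have "q' \<le> sum ?y S" if "winning n v S" for S
      using close[of S] win[OF that] that q' e(1,3) by (auto simp: winning_def)
    moreover have "sum ?y T < q'" if "losing n v T" for T
      using close[of T] lose[OF that] that q' e(1,3) by (auto simp: losing_def)
    ultimately show "is_representation n v q' ?y \<and> q' \<in> {0<..1}"
      using q0 q1 y by (simp add: is_representation_def)
  qed (use e in auto)
qed

section \<open>Measurability of the coordinate map and of the sets averaged over\<close>

lemma from_coords_measurable:
  assumes "n \<ge> 1"
  shows "from_coords n \<in> measurable (\<Pi>\<^sub>M i\<in>{1..<n}. lborel) (\<Pi>\<^sub>M i\<in>{1..n}. lborel)"
  unfolding from_coords_def
proof (rule measurable_fun_upd)
  show "{1..n} = {1..<n} \<union> {n}" using assms by auto
qed measurable

lemma measurable_sum_components: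
  assumes "S \<subseteq> I"
  shows "(\<lambda>w. sum w S) \<in> borel_measurable (\<Pi>\<^sub>M i\<in>I. (lborel :: real measure))"
proof (rule borel_measurable_sum)
  fix i assume "i \<in> S"
  with assms have "i \<in> I" by auto
  then have "(\<lambda>w. w i) \<in> measurable (\<Pi>\<^sub>M i\<in>I. lborel) (lborel :: real measure)"
    by (rule measurable_component_singleton)
  then show "(\<lambda>w. w i) \<in> borel_measurable (\<Pi>\<^sub>M i\<in>I. (lborel :: real measure))" by simp
qed

text \<open>By \<open>feasible_iff\<close> the existential over quotas, a projection, becomes a
  finite conjunction of linear conditions.\<close>

lemma normalized_weights_sets:
  assumes v: "v \<in> simple_games n"
  shows "normalized_weights n v \<in> sets (\<Pi>\<^sub>M i\<in>{1..n}. lborel)"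
proof -
  let ?P = "\<Pi>\<^sub>M i\<in>{1..n}. (lborel :: real measure)"
  \<comment> \<open>Coordinates are written as sums over singletons so that measurability of
    coalition weights handles every condition; extensionality is membership in the space.\<close>
  have "normalized_weights n v = {w \<in> space ?P. (\<forall>i\<in>{1..n}. 0 \<le> sum w {i}) \<and> sum w {1..n} = 1 \<and>
      (\<forall>S\<in>{S. winning n v S}. \<forall>T\<in>{T. losing n v T}. sum w T < sum w S)}"
    by (auto simp: normalized_weights_def feasible_iff[OF v] space_PiM PiE_iff simp del: One_nat_def)
  also have "\<dots> \<in> sets ?P"
    by (intro sets.sets_Collect_conj sets.sets_Collect_finite_All finite_winning finite_losing
        borel_measurable_le borel_measurable_less borel_measurable_eq measurable_sum_components
        borel_measurable_const) (auto simp: winning_def losing_def)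
  finally show ?thesis .
qed

lemma normalized_representations_sets:
  assumes v: "v \<in> simple_games n"
  shows "normalized_representations n v \<in> sets (lborel \<Otimes>\<^sub>M (\<Pi>\<^sub>M i\<in>{1..n}. lborel))"
proof -
  let ?P = "\<Pi>\<^sub>M i\<in>{1..n}. (lborel :: real measure)"
  let ?Q = "(lborel :: real measure) \<Otimes>\<^sub>M ?P"
  have s: "(\<lambda>r. sum (snd r) S) \<in> borel_measurable ?Q" if "S \<subseteq> {1..n}" for S
    by (rule measurable_compose[OF measurable_snd measurable_sum_components[OF that]])
  have f: "(\<lambda>r. fst r) \<in> borel_measurable ?Q" by measurable
  have "normalized_representations n v = {r \<in> space ?Q. 0 < fst r \<and> fst r \<le> 1 \<and>
      (\<forall>i\<in>{1..n}. 0 \<le> sum (snd r) {i}) \<and> sum (snd r) {1..n} = 1 \<and>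
      (\<forall>S\<in>{S. winning n v S}. fst r \<le> sum (snd r) S) \<and>
      (\<forall>T\<in>{T. losing n v T}. sum (snd r) T < fst r)}"
    by (auto simp: normalized_representations_def is_representation_def space_pair_measure
        space_PiM PiE_iff extensional_def simp del: One_nat_def)
  also have "\<dots> \<in> sets ?Q"
    by (intro sets.sets_Collect_conj sets.sets_Collect_finite_All finite_winning finite_losing
        borel_measurable_le borel_measurable_less borel_measurable_eq s f
        borel_measurable_const) (auto simp: winning_def losing_def)
  finally show ?thesis .
qed

section \<open>Positive and finite measure of the sets averaged over\<close>

lemma emeasure_PiM_lborel_box:
  fixes a b :: "nat \<Rightarrow> real"
  assumes "finite I"
  shows "emeasure (\<Pi>\<^sub>M i\<in>I. lborel) (\<Pi>\<^sub>E i\<in>I. {a i<..<b i}) = (\<Prod>i\<in>I. emeasure lborel {a i<..<b i})"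
    and "emeasure (\<Pi>\<^sub>M i\<in>I. lborel) (\<Pi>\<^sub>E i\<in>I. {a i..b i}) = (\<Prod>i\<in>I. emeasure lborel {a i..b i})"
proof -
  interpret product_sigma_finite "\<lambda>i::nat. (lborel :: real measure)" ..
  show "emeasure (\<Pi>\<^sub>M i\<in>I. lborel) (\<Pi>\<^sub>E i\<in>I. {a i<..<b i}) = (\<Prod>i\<in>I. emeasure lborel {a i<..<b i})"
    by (rule emeasure_PiM[OF assms]) simp
  show "emeasure (\<Pi>\<^sub>M i\<in>I. lborel) (\<Pi>\<^sub>E i\<in>I. {a i..b i}) = (\<Prod>i\<in>I. emeasure lborel {a i..b i})"
    by (rule emeasure_PiM[OF assms]) simp
qed

text \<open>Nonnegative weights with sum 1 are each at most 1. The cube provides the finite upper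
  bound for the measures below.\<close>

lemma coords_in_unit_cube:
  assumes n: "n \<ge> 1" and x: "x \<in> space (\<Pi>\<^sub>M i\<in>{1..<n}. (lborel :: real measure))"
    and y: "from_coords n x \<in> {1..n} \<rightarrow>\<^sub>E {0..}"
  shows "x \<in> (\<Pi>\<^sub>E i\<in>{1..<n}. {0..1})"
proof -
  have "0 \<le> x i \<and> x i \<le> 1" if i: "i \<in> {1..<n}" for i
  proof -
    have nn: "0 \<le> from_coords n x j" if "j \<in> {1..n}" for j
      using PiE_mem[OF y that] by simp
    have "from_coords n x i \<le> (\<Sum>j=1..n. from_coords n x j)"
      using i nn by (intro member_le_sum) auto
    then show ?thesis
      using nn[of i] i sum_from_coords[OF n, of x] by (auto simp: from_coords_apply)
  qed
  then show ?thesis using x by (auto simp: space_PiM PiE_iff)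
qed

text \<open>In coordinates the set contains the weight part of the box of representations and lies
  in the unit cube.\<close>

lemma weight_measure_normalized_weights:
  assumes n: "n \<ge> 1" and v: "v \<in> weighted_games n"
  shows "emeasure (weight_measure n) (normalized_weights n v) \<noteq> 0"
    and "emeasure (weight_measure n) (normalized_weights n v) \<noteq> \<infinity>"
proof -
  let ?C = "\<Pi>\<^sub>M i\<in>{1..<n}. (lborel :: real measure)"
  let ?F = "normalized_weights n v"
  let ?A = "from_coords n -` ?F \<inter> space ?C"
  have F: "?F \<in> sets (\<Pi>\<^sub>M i\<in>{1..n}. lborel)"
    by (rule normalized_weights_sets[OF weighted_games_simple[OF v]])
  have fm: "from_coords n \<in> measurable ?C (\<Pi>\<^sub>M i\<in>{1..n}. lborel)"
    using n by (rule from_coords_measurable)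
  have em: "emeasure (weight_measure n) ?F = emeasure ?C ?A"
    unfolding weight_measure_def by (rule emeasure_distr[OF fm F])
  have A: "?A \<in> sets ?C" by (rule measurable_sets[OF fm F])
  obtain q e :: real and w where e: "e > 0" and box:
    "\<And>q' x. q' \<in> {q - e<..<q + e} \<Longrightarrow> x \<in> (\<Pi>\<^sub>E i\<in>{1..<n}. {w i - e<..<w i + e}) \<Longrightarrow>
       is_representation n v q' (from_coords n x) \<and> q' \<in> {0<..1}"
    by (rule ex_box_of_representations[OF n v]) blast
  have "(\<Pi>\<^sub>E i\<in>{1..<n}. {w i - e<..<w i + e}) \<subseteq> ?A"
  proof
    fix x assume x: "x \<in> (\<Pi>\<^sub>E i\<in>{1..<n}. {w i - e<..<w i + e})"
    \<comment> \<open>The quota is frozen at the centre \<open>q\<close> of its interval.\<close>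
    then have "feasible n v (from_coords n x)"
      using box[of q x] e by (auto simp: feasible_def)
    with x show "x \<in> ?A"
      using sum_from_coords[OF n, of x] by (auto simp: normalized_weights_def space_PiM PiE_iff)
  qed
  \<comment> \<open>The box has volume \<open>(2 * e) ^ (n - 1)\<close>; for \<open>n = 1\<close>
    this is the empty product 1, the mass of the single point.\<close>
  from emeasure_mono[OF this A] show "emeasure (weight_measure n) ?F \<noteq> 0"
    using e unfolding em emeasure_PiM_lborel_box(1)[OF finite_atLeastLessThan]
    by (auto simp: prod_ennreal)
  have "?A \<subseteq> (\<Pi>\<^sub>E i\<in>{1..<n}. {0..1})"
    using coords_in_unit_cube[OF n]
    by (auto simp: normalized_weights_def feasible_def is_representation_def)
  then have "emeasure ?C ?A \<le> emeasure ?C (\<Pi>\<^sub>E i\<in>{1..<n}. {0..1})"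
    by (rule emeasure_mono) (auto intro!: sets_PiM_I_finite)
  also have "\<dots> = 1"
    using emeasure_PiM_lborel_box(2)[OF finite_atLeastLessThan, of 1 n "\<lambda>_. 0" "\<lambda>_. 1"] by simp
  finally show "emeasure (weight_measure n) ?F \<noteq> \<infinity>"
    unfolding em by (auto simp: top_unique)
qed

text \<open>The same sandwich with the quota as an additional factor: an open interval times the box
  inside, the unit interval times the unit cube outside.\<close>

lemma representation_measure_normalized_representations:
  assumes n: "n \<ge> 1" and v: "v \<in> weighted_games n"
  shows "emeasure (representation_measure n) (normalized_representations n v) \<noteq> 0"
    and "emeasure (representation_measure n) (normalized_representations n v) \<noteq> \<infinity>"
proof -
  let ?C = "\<Pi>\<^sub>M i\<in>{1..<n}. (lborel :: real measure)"
  let ?Q = "(lborel :: real measure) \<Otimes>\<^sub>M ?C"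
  let ?F = "normalized_representations n v"
  let ?f = "\<lambda>(q, x). (q :: real, from_coords n x)"
  let ?A = "?f -` ?F \<inter> space ?Q"
  interpret product_sigma_finite "\<lambda>i::nat. (lborel :: real measure)" ..
  \<comment> \<open>Sigma-finiteness of the second factor gives the product formula for the measure
    of rectangles.\<close>
  interpret C: sigma_finite_measure ?C by (rule sigma_finite) simp
  have F: "?F \<in> sets (lborel \<Otimes>\<^sub>M (\<Pi>\<^sub>M i\<in>{1..n}. lborel))"
    by (rule normalized_representations_sets[OF weighted_games_simple[OF v]])
  have [measurable]: "from_coords n \<in> measurable ?C (\<Pi>\<^sub>M i\<in>{1..n}. lborel)"
    using n by (rule from_coords_measurable)
  have fm: "?f \<in> measurable ?Q (lborel \<Otimes>\<^sub>M (\<Pi>\<^sub>M i\<in>{1..n}. lborel))"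
    by measurable
  have em: "emeasure (representation_measure n) ?F = emeasure ?Q ?A"
    unfolding representation_measure_def by (rule emeasure_distr[OF fm F])
  have A: "?A \<in> sets ?Q" by (rule measurable_sets[OF fm F])
  obtain q e :: real and w where e: "e > 0" and box:
    "\<And>q' x. q' \<in> {q - e<..<q + e} \<Longrightarrow> x \<in> (\<Pi>\<^sub>E i\<in>{1..<n}. {w i - e<..<w i + e}) \<Longrightarrow>
       is_representation n v q' (from_coords n x) \<and> q' \<in> {0<..1}"
    by (rule ex_box_of_representations[OF n v]) blast
  let ?B = "\<Pi>\<^sub>E i\<in>{1..<n}. {w i - e<..<w i + e}"
  have B: "?B \<in> sets ?C" by (intro sets_PiM_I_finite) auto
  have interval: "{q - e<..<q + e} \<in> sets lborel" by simp
  have "{q - e<..<q + e} \<times> ?B \<subseteq> ?A"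
  proof (rule subsetI, clarify)
    fix q' x assume q': "q' \<in> {q - e<..<q + e}" and x: "x \<in> ?B"
    show "(q', x) \<in> ?A"
      using box[OF q' x] sum_from_coords[OF n, of x] x
      by (auto simp: normalized_representations_def space_pair_measure space_PiM PiE_iff)
  qed
  from emeasure_mono[OF this A] show "emeasure (representation_measure n) ?F \<noteq> 0"
    using e unfolding em C.emeasure_pair_measure_Times[OF interval B]
      emeasure_PiM_lborel_box(1)[OF finite_atLeastLessThan]
    by (auto simp: prod_ennreal)
  let ?U = "\<Pi>\<^sub>E i\<in>{1..<n}. {0..1::real}"
  have U: "?U \<in> sets ?C" by (intro sets_PiM_I_finite) auto
  have "?A \<subseteq> {0..1} \<times> ?U"
  proof
    fix r assume "r \<in> ?A"
    then show "r \<in> {0..1} \<times> ?U"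
      using coords_in_unit_cube[OF n, of "snd r"]
      by (cases r) (auto simp: normalized_representations_def is_representation_def space_pair_measure)
  qed
  then have "emeasure ?Q ?A \<le> emeasure ?Q ({0..1} \<times> ?U)"
    by (rule emeasure_mono) (use U in auto)
  also have "\<dots> = 1"
    using emeasure_PiM_lborel_box(2)[OF finite_atLeastLessThan, of 1 n "\<lambda>_. 0" "\<lambda>_. 1"]
      C.emeasure_pair_measure_Times[OF _ U, of "{0..1::real}" lborel] by simp
  finally show "emeasure (representation_measure n) ?F \<noteq> \<infinity>"
    unfolding em by (auto simp: top_unique)
qed

theorem mainTheorem1:
  fixes n :: nat
  assumes "n \<ge> 1"
  shows "representation_compatible n (AWI n) \<and> representation_compatible n (ARI n)"
proof -
  have "feasible n v (AWI n v) \<and> feasible n v (ARI n v)" if v: "v \<in> weighted_games n" for v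
  proof
    have sg: "v \<in> simple_games n" by (rule weighted_games_simple[OF v])
    have comp: "(\<lambda>w. w i) \<in> borel_measurable (\<Pi>\<^sub>M i\<in>{1..n}. (lborel :: real measure))"
      if "i \<in> {1..n}" for i
      using measurable_sum_components[of "{i}" "{1..n}"] that by simp
    show "feasible n v (AWI n v)"
      unfolding AWI_def
    \<comment> \<open>Here the points are the weight vectors themselves, so \<open>p\<close> is the
      identity.\<close>
    proof (rule average_feasible[OF sg _ weight_measure_normalized_weights[OF assms v]])
      show "normalized_weights n v \<in> sets (weight_measure n)"
        using normalized_weights_sets[OF sg] by (simp add: weight_measure_def)
    qed (use comp in \<open>auto simp: normalized_weights_def weight_measure_def\<close>)
    show "feasible n v (ARI n v)"
      unfolding ARI_def
    \<comment> \<open>Here \<open>p\<close> is \<open>snd\<close>, which discards the quota.\<close>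
    proof (rule average_feasible[OF sg _ representation_measure_normalized_representations[OF assms v]])
      show "normalized_representations n v \<in> sets (representation_measure n)"
        using normalized_representations_sets[OF sg] by (simp add: representation_measure_def)
      show "(\<lambda>r. snd r i) \<in> borel_measurable (representation_measure n)" if "i \<in> {1..n}" for i
        using measurable_compose[OF measurable_snd comp[OF that]]
        by (simp add: representation_measure_def)
    qed (auto simp: normalized_representations_def feasible_def)
  qed
  then show ?thesis unfolding representation_compatible_def by blast
qed

end
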